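(* Let $n\ge1$ be an integer, let $1\le p<\infty$ and $0<\alpha<n$. If $\frac{np}{\alpha}\le\kappa<\infty$, then $L^p_\kappa\subseteq\tilde S_{p,\alpha}$.
   Context: For a measurable function $f:\mathbb{R}^n\to\mathbb{R}$, the distribution function is $D_f(\sigma):=|\{x\in\mathbb{R}^n:|f(x)|>\sigma\}|$ for $\sigma>0$ ($|E|$ is Lebesgue measure), and the decreasing rearrangement is $f^*(t):=\inf\{\sigma:D_f(\sigma)\le t\}$ for $t\ge0$. For $0<\kappa<\infty$ and $0<p<\infty$ the Lorentz space $L^p_\kappa=L^p_\kappa(\mathbb{R}^n)$ is the set of all measurable $f:\mathbb{R}^n\to\mathbb{R}$ with $$\|f\|_{L^p_\kappa}:=\left(\int_0^\infty\left(t^{1/\kappa}f^*(t)\right)^p\frac{dt}{t}\right)^{1/p}<\infty.$$ (The lower index $\kappa$ is the primary Lorentz index and the upper index $p$ the secondary one.) For $0<\alpha<n$ and $1\le p<\infty$, the bounded Stummel modulus class is $$\tilde S_{p,\alpha}=\tilde S_{p,\alpha}(\mathbb{R}^n):=\{f\in L^p_{\rm loc}(\mathbb{R}^n):\ \eta_{p,\alpha}f(r)<\infty\ \text{for all } r>0\},$$ where $$\eta_{p,\alpha}f(r):=\sup_{x\in\mathbb{R}^n}\left(\int_{|x-y|<r}\frac{|f(y)|^p}{|x-y|^{n-\alpha}}\,dy\right)^{1/p},\quad r>0.$$ *)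

theory Defs
  imports "HOL-Analysis.Analysis"
begin

text \<open>
  Distribution functions, rearrangements, integrals and suprema may be infinite, so they
  are taken in \<^typ>\<open>ennreal\<close>. The library has no real powers there; the following is the
  power function for exponents \<open>p > 0\<close>, with \<open>\<infinity>\<close> raised to \<open>p\<close> being \<open>\<infinity>\<close>.
\<close>

definition ennpow :: "ennreal \<Rightarrow> real \<Rightarrow> ennreal" where
  "ennpow x p = (if x = \<infinity> then \<infinity> else ennreal (enn2real x powr p))"

definition distr_fun :: "(real ^ 'n \<Rightarrow> real) \<Rightarrow> real \<Rightarrow> ennreal" where
  "distr_fun f \<sigma> = emeasure lebesgue {x. \<bar>f x\<bar> > \<sigma>}"

text \<open>If no level \<open>\<sigma>\<close> qualifies, the value is \<open>Inf {} = \<infinity>\<close>.\<close>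

definition decr_rearr :: "(real ^ 'n \<Rightarrow> real) \<Rightarrow> real \<Rightarrow> ennreal" where
  "decr_rearr f t = Inf {ennreal \<sigma> | \<sigma>. \<sigma> > 0 \<and> distr_fun f \<sigma> \<le> ennreal t}"

definition lorentz_norm :: "real \<Rightarrow> real \<Rightarrow> (real ^ 'n \<Rightarrow> real) \<Rightarrow> ennreal" where
  "lorentz_norm \<kappa> p f =
     ennpow (\<integral>\<^sup>+ t \<in> {0<..}.
               (ennpow (ennreal (t powr (1 / \<kappa>)) * decr_rearr f t) p / ennreal t) \<partial>lborel)
            (1 / p)"

text \<open>
  The first argument \<open>\<kappa>\<close> is the primary Lorentz index (written as a lower index),
  the second argument \<open>p\<close> the secondary one (written as an upper index).
\<close>

definition lorentz_space :: "real \<Rightarrow> real \<Rightarrow> (real ^ 'n \<Rightarrow> real) set" where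
  "lorentz_space \<kappa> p = {f. f \<in> borel_measurable lebesgue \<and> lorentz_norm \<kappa> p f < \<infinity>}"

definition Lp_loc :: "real \<Rightarrow> (real ^ 'n \<Rightarrow> real) set" where
  "Lp_loc p = {f. f \<in> borel_measurable lebesgue \<and>
     (\<forall>K. compact K \<longrightarrow> (\<integral>\<^sup>+ y \<in> K. ennreal (\<bar>f y\<bar> powr p) \<partial>lebesgue) < \<infinity>)}"

text \<open>The value of the integrand at \<open>y = x\<close> is irrelevant, since points are null sets.\<close>

definition stummel_modulus :: "real \<Rightarrow> real \<Rightarrow> (real ^ 'n \<Rightarrow> real) \<Rightarrow> real \<Rightarrow> ennreal" where
  "stummel_modulus p \<alpha> f r =
     (SUP x. ennpow (\<integral>\<^sup>+ y \<in> {y. norm (x - y) < r}.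
               ennreal (\<bar>f y\<bar> powr p / norm (x - y) powr (real CARD('n) - \<alpha>)) \<partial>lebesgue)
            (1 / p))"

definition bounded_stummel :: "real \<Rightarrow> real \<Rightarrow> (real ^ 'n \<Rightarrow> real) set" where
  "bounded_stummel p \<alpha> = {f \<in> Lp_loc p. \<forall>r>0. stummel_modulus p \<alpha> f r < \<infinity>}"

end

theory Submission
  imports Defs
begin

text \<open>
  Splitting the kernel \<open>|x - y|\<close> to the power \<open>\<alpha> - n\<close> at the radius \<open>m\<close> to the power \<open>1 / n\<close>
  shows that its integral over a set of measure \<open>m\<close> is at most a constant times \<open>m\<close> to the
  power \<open>\<alpha> / n\<close>. Apply this to the superlevel sets of \<open>|f|\<close> to the power \<open>p\<close> inside a ball of
  measure \<open>M\<close>, write \<open>m\<close> to the power \<open>\<alpha> / n\<close> as an integral of \<open>t\<close> to the power \<open>\<alpha> / n - 1\<close>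
  over \<open>0 < t < m\<close>, and exchange the integrals: the levels whose superlevel set has measure
  above \<open>t\<close> form an interval of length at most \<open>f\<^sup>*(t)\<close> to the power \<open>p\<close>. Only \<open>t < M\<close>
  contribute, and there the hypothesis on \<open>\<kappa>\<close> gives \<open>t\<close> to the power \<open>\<alpha> / n\<close> at most a constant
  times \<open>t\<close> to the power \<open>p / \<kappa>\<close>, so the Lorentz integral is a bound independent of \<open>x\<close>.
\<close>

section \<open>Sigma-finiteness and integrals of powers\<close>

text \<open>Tonelli will pair \<open>lebesgue\<close> with \<open>lborel\<close>, so both must be
  sigma-finite. Completion keeps the measure of Borel sets, hence a countable cover by sets of
  finite \<open>lborel\<close> measure still serves.\<close>

lemma sigma_finite_lebesgue: "sigma_finite_measure (lebesgue :: 'a::euclidean_space measure)"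
proof -
  obtain A :: "'a set set" where "countable A" "A \<subseteq> sets lborel" "\<Union>A = space lborel"
      "\<forall>a\<in>A. emeasure lborel a \<noteq> \<infinity>"
    using lborel.sigma_finite_countable by blast
  then show ?thesis
    by (intro sigma_finite_measure.intro exI[of _ A]) (auto simp: subset_iff emeasure_completion)
qed

lemma nn_integral_powr_Icc:
  assumes "0 < a" "0 \<le> m"
  shows "(\<integral>\<^sup>+ t. ennreal (t powr (a - 1)) * indicator {0..m} t \<partial>lborel) = ennreal (m powr a / a)"
  using nn_integral_has_integral_lebesgue'[OF _ has_integral_powr_from_0[of "a - 1" m]] assms
  by simp

lemma nn_integral_powr_Ioo:
  assumes "0 < a" "0 \<le> m"
  shows "(\<integral>\<^sup>+ t. ennreal (t powr (a - 1)) * indicator {0<..<m} t \<partial>lborel) = ennreal (m powr a / a)"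
proof -
  have "AE t in lborel. t \<noteq> (0::real)" "AE t in lborel. t \<noteq> m"
    by (rule AE_lborel_singleton)+
  then have "AE t in lborel. ennreal (t powr (a - 1)) * indicator {0<..<m} t
      = ennreal (t powr (a - 1)) * indicator {0..m} t"
    by eventually_elim (auto simp: indicator_def)
  from nn_integral_cong_AE[OF this] show ?thesis
    using nn_integral_powr_Icc[OF assms] by simp
qed

text \<open>The fundamental theorem of calculus gives equality for \<open>0 < u < d\<close>; for
  \<open>d \<le> u\<close> the first summand is enough, and at \<open>u = 0\<close> the left side is
  0 because \<open>powr\<close> has base 0. With \<open>u\<close> a distance, the integral
  superposes indicators of balls, which prepares an exchange of integrals.\<close>

lemma powr_minus_le_layers:
  fixes \<beta> d u :: real
  assumes "0 < \<beta>" "0 < d" "0 \<le> u"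
  shows "ennreal (u powr - \<beta>) \<le>
    ennreal (d powr - \<beta>) + (\<integral>\<^sup>+ v. ennreal (\<beta> * v powr (- \<beta> - 1)) * indicator {u..d} v \<partial>lborel)"
proof (cases "u = 0 \<or> d \<le> u")
  case True
  then show ?thesis
  proof
    assume "d \<le> u"
    then have "u powr - \<beta> \<le> d powr - \<beta>"
      using assms by (intro powr_mono2') auto
    then show ?thesis
      by (intro add_increasing2) (auto intro: ennreal_leI)
  qed simp
next
  case False
  then have u: "0 < u" "u < d" using assms by auto
  have "((\<lambda>v. - (v powr - \<beta>)) has_vector_derivative \<beta> * v powr (- \<beta> - 1)) (at v within {u..d})"
    if "v \<in> {u..d}" for v
    using that u unfolding has_real_derivative_iff_has_vector_derivative[symmetric]
    by (auto intro!: derivative_eq_intros)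
  from fundamental_theorem_of_calculus[OF _ this]
  have I: "((\<lambda>v. \<beta> * v powr (- \<beta> - 1)) has_integral (u powr - \<beta> - d powr - \<beta>)) {u..d}"
    using u by simp
  have "(\<integral>\<^sup>+ v. ennreal (\<beta> * v powr (- \<beta> - 1)) * indicator {u..d} v \<partial>lborel)
      = ennreal (u powr - \<beta> - d powr - \<beta>)"
    using nn_integral_has_integral_lebesgue'[OF _ I] assms by simp
  moreover have "d powr - \<beta> \<le> u powr - \<beta>"
    using assms u by (intro powr_mono2') auto
  ultimately show ?thesis
    by (simp flip: ennreal_plus)
qed

section \<open>The Riesz kernel on sets of finite measure\<close>

text \<open>The part of the kernel below a fixed height contributes at most that height times
  \<open>m\<close>. The excess is a superposition of balls around \<open>x\<close> of bounded
  radius, whose volumes are explicit.\<close>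

lemma nn_integral_Riesz_kernel_le:
  fixes x :: "'a::euclidean_space" and \<alpha> m :: real
  defines "n \<equiv> real DIM('a)"
  assumes \<alpha>: "0 < \<alpha>" "\<alpha> < n"
    and E: "E \<in> sets lebesgue" "emeasure lebesgue E = ennreal m" "0 \<le> m"
  shows "(\<integral>\<^sup>+ y. ennreal (norm (x - y) powr (\<alpha> - n)) * indicator E y \<partial>lebesgue)
    \<le> ennreal ((1 + (n - \<alpha>) * unit_ball_vol n / \<alpha>) * m powr (\<alpha> / n))"
proof (cases "m = 0")
  \<comment> \<open>The radius \<open>d\<close> chosen in the other case would be 0 here, which the
    layer inequality excludes; but \<open>E\<close> is null.\<close>
  case True
  then have "AE y in lebesgue. y \<notin> E"
    using E by (intro AE_not_in) (auto simp: null_sets_def)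
  then have "(\<integral>\<^sup>+ y. ennreal (norm (x - y) powr (\<alpha> - n)) * indicator E y \<partial>lebesgue)
     = (\<integral>\<^sup>+ y. 0 \<partial>(lebesgue :: 'a measure))"
    by (intro nn_integral_cong_AE) (auto simp: indicator_def)
  then show ?thesis by simp
next
  case False
  interpret L: sigma_finite_measure "lebesgue :: 'a measure"
    by (rule sigma_finite_lebesgue)
  interpret P: pair_sigma_finite "lebesgue :: 'a measure" "lborel :: real measure" ..
  define \<beta> where "\<beta> = n - \<alpha>"
  define V where "V = unit_ball_vol n"
  \<comment> \<open>This radius balances the two contributions: \<open>d powr - \<beta> * m\<close>
    and \<open>d powr \<alpha>\<close> both equal \<open>m powr (\<alpha> / n)\<close>.\<close>
  define d where "d = m powr (1 / n)"
  have n: "0 < n" by (simp add: n_def)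
  have \<beta>: "0 < \<beta>" using \<alpha> by (simp add: \<beta>_def)
  have V: "0 \<le> V" using n by (simp add: V_def)
  have d: "0 < d" using False by (simp add: d_def)
  have [measurable]: "(\<lambda>y. norm (x - y)) \<in> borel_measurable lebesgue"
    by (rule measurable_completion) simp
  note [measurable] = E(1)
  let ?h = "\<lambda>v. ennreal (\<beta> * v powr (- \<beta> - 1))"
  have "(\<integral>\<^sup>+ y. ennreal (norm (x - y) powr (\<alpha> - n)) * indicator E y \<partial>lebesgue) \<le>
    (\<integral>\<^sup>+ y. ennreal (d powr - \<beta>) * indicator E y +
       (\<integral>\<^sup>+ v. ?h v * indicator {norm (x - y)..d} v * indicator E y \<partial>lborel) \<partial>lebesgue)"
  proof (rule nn_integral_mono)
    fix y
    show "ennreal (norm (x - y) powr (\<alpha> - n)) * indicator E y \<le> ennreal (d powr - \<beta>) * indicator E y +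
       (\<integral>\<^sup>+ v. ?h v * indicator {norm (x - y)..d} v * indicator E y \<partial>lborel)"
      using powr_minus_le_layers[OF \<beta> d norm_ge_zero, of "x - y"]
      by (auto simp: indicator_def \<beta>_def)
  qed
  also have "\<dots> = (\<integral>\<^sup>+ y. ennreal (d powr - \<beta>) * indicator E y \<partial>lebesgue) +
    (\<integral>\<^sup>+ y. (\<integral>\<^sup>+ v. ?h v * indicator {norm (x - y)..d} v * indicator E y \<partial>lborel) \<partial>lebesgue)"
    by (intro nn_integral_add) (measurable, simp add: indicator_def, measurable)
  also have "(\<integral>\<^sup>+ y. ennreal (d powr - \<beta>) * indicator E y \<partial>lebesgue) = ennreal (d powr - \<beta> * m)"
    using E by (simp add: nn_integral_cmult_indicator ennreal_mult)
  also have "(\<integral>\<^sup>+ y. (\<integral>\<^sup>+ v. ?h v * indicator {norm (x - y)..d} v * indicator E y \<partial>lborel) \<partial>lebesgue)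
     = (\<integral>\<^sup>+ v. (\<integral>\<^sup>+ y. ?h v * indicator {norm (x - y)..d} v * indicator E y \<partial>lebesgue) \<partial>lborel)"
    by (rule P.Fubini'[symmetric]) (simp add: indicator_def)
  also have "\<dots> \<le> (\<integral>\<^sup>+ v. ennreal (\<beta> * V) * (ennreal (v powr (\<alpha> - 1)) * indicator {0..d} v) \<partial>lborel)"
  proof (rule nn_integral_mono)
    fix v :: real
    show "(\<integral>\<^sup>+ y. ?h v * indicator {norm (x - y)..d} v * indicator E y \<partial>lebesgue)
       \<le> ennreal (\<beta> * V) * (ennreal (v powr (\<alpha> - 1)) * indicator {0..d} v)"
    proof (cases "0 < v \<and> v \<le> d")
      case True
      \<comment> \<open>Forgetting \<open>E\<close> leaves a full ball, whose volume turns the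
        exponent \<open>- \<beta> - 1\<close> into \<open>\<alpha> - 1\<close>, integrable at
        0.\<close>
      have "(\<integral>\<^sup>+ y. ?h v * indicator {norm (x - y)..d} v * indicator E y \<partial>lebesgue)
        \<le> (\<integral>\<^sup>+ y. ?h v * indicator (cball x v) y \<partial>lebesgue)"
        by (intro nn_integral_mono) (auto simp: indicator_def dist_norm)
      also have "\<dots> = ?h v * ennreal (V * v ^ DIM('a))"
        using True by (simp add: nn_integral_cmult_indicator emeasure_completion emeasure_cball V_def n_def)
      also have "\<dots> = ennreal (\<beta> * V * (v powr (- \<beta> - 1) * v powr n))"
        using True \<beta> V by (simp add: n_def powr_realpow mult_ac flip: ennreal_mult)
      also have "v powr (- \<beta> - 1) * v powr n = v powr (\<alpha> - 1)"
        by (simp add: \<beta>_def flip: powr_add)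
      finally show ?thesis
        using True \<beta> V by (simp add: ennreal_mult)
    next
      case False
      \<comment> \<open>At \<open>v = 0\<close> and \<open>y = x\<close> the indicators need not
        vanish, but the power of base 0 does.\<close>
      then have zero: "ennreal (\<beta> * v powr (- \<beta> - 1)) * indicator {norm (x - y)..d} v * indicator E y = 0" for y
        by (cases "v = 0") (auto simp: indicator_def dest: order_trans[OF norm_ge_zero])
      show ?thesis by (simp only: zero) simp
    qed
  qed
  also have "\<dots> = ennreal (\<beta> * V) * ennreal (d powr \<alpha> / \<alpha>)"
    using \<alpha> d by (subst nn_integral_cmult) (auto simp: nn_integral_powr_Icc)
  also have "ennreal (d powr - \<beta> * m) + ennreal (\<beta> * V) * ennreal (d powr \<alpha> / \<alpha>)
     = ennreal (d powr - \<beta> * m + \<beta> * V * (d powr \<alpha> / \<alpha>))"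
    using \<alpha> \<beta> V E(3) by (simp flip: ennreal_mult ennreal_plus)
  also have "d powr - \<beta> * m = m powr (\<alpha> / n)"
  proof -
    have "d powr - \<beta> * m = m powr (- \<beta> / n + 1)"
      using False E(3) unfolding d_def powr_powr powr_add by simp
    also have "- \<beta> / n + 1 = \<alpha> / n" using n by (simp add: \<beta>_def field_simps)
    finally show ?thesis .
  qed
  also have "d powr \<alpha> = m powr (\<alpha> / n)"
    by (simp add: d_def powr_powr)
  finally show ?thesis
    unfolding \<beta>_def V_def by (simp only: add_left_mono distrib_right mult_1 times_divide_eq_left times_divide_eq_right True_implies_equals)
qed

text \<open>Two layer decompositions are combined: \<open>g y\<close> is the length of
  \<open>{0<..<g y}\<close>, and \<open>m s powr (\<alpha> / n)\<close> is
  \<open>\<alpha> / n\<close> times an integral over \<open>0 < t < m s\<close>, which is where that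
  factor comes from. Measurability of \<open>m\<close> is a separate conclusion because it is needed
  again to see that the lengths of the level sets are measurable in \<open>t\<close>.\<close>

lemma
  fixes x :: "'a::euclidean_space" and g :: "'a \<Rightarrow> real" and \<alpha> :: real
  defines "n \<equiv> real DIM('a)"
  assumes \<alpha>: "0 < \<alpha>" "\<alpha> < n"
    and g[measurable]: "g \<in> borel_measurable lebesgue"
    and B[measurable]: "B \<in> sets lebesgue" and fin: "emeasure lebesgue B < \<infinity>"
  defines "m \<equiv> \<lambda>s. measure lebesgue {y \<in> B. s < g y}"
  shows borel_measurable_superlevel_measure: "m \<in> borel_measurable borel"
    and nn_integral_Riesz_kernel_layer_cake:
      "(\<integral>\<^sup>+ y. ennreal (norm (x - y) powr (\<alpha> - n)) * ennreal (g y) * indicator B y \<partial>lebesgue)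
    \<le> ennreal ((1 + (n - \<alpha>) * unit_ball_vol n / \<alpha>) * (\<alpha> / n)) *
      (\<integral>\<^sup>+ t. ennreal (t powr (\<alpha> / n - 1)) * emeasure lborel {s. 0 < s \<and> t < m s} * indicator {0<..} t \<partial>lborel)"
proof -
  interpret L: sigma_finite_measure "lebesgue :: 'a measure"
    by (rule sigma_finite_lebesgue)
  interpret P: pair_sigma_finite "lebesgue :: 'a measure" "lborel :: real measure" ..
  define C where "C = 1 + (n - \<alpha>) * unit_ball_vol n / \<alpha>"
  have n: "0 < n" by (simp add: n_def)
  have C: "0 \<le> C" using \<alpha> n by (simp add: C_def)
  have [measurable]: "(\<lambda>y. norm (x - y)) \<in> borel_measurable lebesgue"
    by (rule measurable_completion) simp
  have sub: "{y \<in> B. s < g y} \<in> sets lebesgue" for s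
    by measurable
  \<comment> \<open>Finiteness of the measure of \<open>B\<close> rules out the default value 0 that
    \<open>measure\<close> takes on sets of infinite measure.\<close>
  have m_eq: "emeasure lebesgue {y \<in> B. s < g y} = ennreal (m s)" for s
  proof -
    have "emeasure lebesgue {y \<in> B. s < g y} \<le> emeasure lebesgue B"
      by (rule emeasure_mono[OF _ B]) blast
    also note fin
    finally show ?thesis
      unfolding m_def by (intro emeasure_eq_ennreal_measure) (simp only: less_top infinity_ennreal_def)
  qed
  have m0: "0 \<le> m s" for s by (simp add: m_def)
  \<comment> \<open>Measurability follows from monotonicity, applied to the decreasing
    \<open>m\<close> with its sign reversed.\<close>
  have "mono (\<lambda>s. - m s)"
  proof (rule monoI)
    fix s t :: real assume "s \<le> t"
    then have "emeasure lebesgue {y \<in> B. t < g y} \<le> emeasure lebesgue {y \<in> B. s < g y}"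
      by (intro emeasure_mono sub) auto
    then show "- m s \<le> - m t"
      using m0 by (simp add: m_eq)
  qed
  from borel_measurable_uminus[OF borel_measurable_mono[OF this]]
  show m_meas[measurable]: "m \<in> borel_measurable borel" by simp
  let ?w = "\<lambda>y. ennreal (norm (x - y) powr (\<alpha> - n))"
  \<comment> \<open>For negative \<open>g y\<close> the interval is empty and \<open>ennreal\<close>
    truncates to 0.\<close>
  have layer: "emeasure lborel {0<..<g y} = ennreal (g y)" for y
    by (cases "0 \<le> g y") (auto simp: ennreal_neg)
  have "(\<integral>\<^sup>+ y. ?w y * ennreal (g y) * indicator B y \<partial>lebesgue)
      = (\<integral>\<^sup>+ y. (\<integral>\<^sup>+ s. ?w y * indicator B y * indicator {0<..<g y} s \<partial>lborel) \<partial>lebesgue)"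
    by (intro nn_integral_cong, subst nn_integral_cmult_indicator) (simp_all add: layer mult_ac)
  also have "\<dots> = (\<integral>\<^sup>+ s. (\<integral>\<^sup>+ y. ?w y * indicator B y * indicator {0<..<g y} s \<partial>lebesgue) \<partial>lborel)"
    by (rule P.Fubini'[symmetric]) (simp add: indicator_def)
  also have "\<dots> \<le> (\<integral>\<^sup>+ s. ennreal (C * m s powr (\<alpha> / n)) * indicator {0<..} s \<partial>lborel)"
  proof (rule nn_integral_mono)
    fix s :: real
    have "(\<integral>\<^sup>+ y. ?w y * indicator B y * indicator {0<..<g y} s \<partial>lebesgue)
      = (\<integral>\<^sup>+ y. ?w y * indicator {y \<in> B. s < g y} y * indicator {0<..} s \<partial>lebesgue)"
      by (intro nn_integral_cong) (auto simp: indicator_def)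
    also have "\<dots> = (\<integral>\<^sup>+ y. ?w y * indicator {y \<in> B. s < g y} y \<partial>lebesgue) * indicator {0<..} s"
      by (rule nn_integral_multc) measurable
    also have "\<dots> \<le> ennreal (C * m s powr (\<alpha> / n)) * indicator {0<..} s"
      unfolding C_def n_def using \<alpha>[unfolded n_def]
      by (intro mult_right_mono nn_integral_Riesz_kernel_le[OF _ _ sub m_eq m0]) auto
    finally show "(\<integral>\<^sup>+ y. ?w y * indicator B y * indicator {0<..<g y} s \<partial>lebesgue)
      \<le> ennreal (C * m s powr (\<alpha> / n)) * indicator {0<..} s" .
  qed
  \<comment> \<open>Second layer decomposition, now of the power of \<open>m s\<close>; after the
    exchange below, integrating in \<open>s\<close> first yields the length of a set of
    levels.\<close>
  also have "\<dots> = (\<integral>\<^sup>+ s. (\<integral>\<^sup>+ t. ennreal (C * (\<alpha> / n)) * (ennreal (t powr (\<alpha> / n - 1)) *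
      indicator {0<..<m s} t * indicator {0<..} s) \<partial>lborel) \<partial>lborel)"
  proof (rule nn_integral_cong)
    fix s :: real
    have "(\<integral>\<^sup>+ t. ennreal (C * (\<alpha> / n)) * (ennreal (t powr (\<alpha> / n - 1)) *
        indicator {0<..<m s} t * indicator {0<..} s) \<partial>lborel)
      = ennreal (C * (\<alpha> / n)) * ((\<integral>\<^sup>+ t. ennreal (t powr (\<alpha> / n - 1)) *
        indicator {0<..<m s} t \<partial>lborel) * indicator {0<..} s)"
      by (simp add: nn_integral_cmult nn_integral_multc)
    also have "\<dots> = ennreal (C * m s powr (\<alpha> / n)) * indicator {0<..} s"
      using \<alpha> n C m0[of s]
      by (simp add: nn_integral_powr_Ioo flip: ennreal_mult mult.assoc)
    finally show "ennreal (C * m s powr (\<alpha> / n)) * indicator {0<..} s =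
      (\<integral>\<^sup>+ t. ennreal (C * (\<alpha> / n)) * (ennreal (t powr (\<alpha> / n - 1)) *
        indicator {0<..<m s} t * indicator {0<..} s) \<partial>lborel)" ..
  qed
  also have "\<dots> = (\<integral>\<^sup>+ t. (\<integral>\<^sup>+ s. ennreal (C * (\<alpha> / n)) * (ennreal (t powr (\<alpha> / n - 1)) *
      indicator {0<..<m s} t * indicator {0<..} s) \<partial>lborel) \<partial>lborel)"
    by (rule lborel_pair.Fubini'[symmetric]) (simp add: indicator_def)
  also have "\<dots> = (\<integral>\<^sup>+ t. ennreal (C * (\<alpha> / n)) * (\<integral>\<^sup>+ s. ennreal (t powr (\<alpha> / n - 1)) *
      indicator {0<..<m s} t * indicator {0<..} s \<partial>lborel) \<partial>lborel)"
    by (intro nn_integral_cong nn_integral_cmult) (simp add: indicator_def)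
  also have "\<dots> = ennreal (C * (\<alpha> / n)) * (\<integral>\<^sup>+ t. (\<integral>\<^sup>+ s. ennreal (t powr (\<alpha> / n - 1)) *
      indicator {0<..<m s} t * indicator {0<..} s \<partial>lborel) \<partial>lborel)"
    by (intro nn_integral_cmult) (simp add: indicator_def)
  also have "(\<integral>\<^sup>+ t. (\<integral>\<^sup>+ s. ennreal (t powr (\<alpha> / n - 1)) *
      indicator {0<..<m s} t * indicator {0<..} s \<partial>lborel) \<partial>lborel)
    = (\<integral>\<^sup>+ t. ennreal (t powr (\<alpha> / n - 1)) * emeasure lborel {s. 0 < s \<and> t < m s} * indicator {0<..} t \<partial>lborel)"
  proof (rule nn_integral_cong)
    fix t :: real
    have [measurable]: "{s. 0 < s \<and> t < m s} \<in> sets lborel" by simp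
    have "(\<integral>\<^sup>+ s. ennreal (t powr (\<alpha> / n - 1)) * indicator {0<..<m s} t * indicator {0<..} s \<partial>lborel)
      = (\<integral>\<^sup>+ s. ennreal (t powr (\<alpha> / n - 1)) * indicator {0<..} t * indicator {s. 0 < s \<and> t < m s} s \<partial>lborel)"
      by (intro nn_integral_cong) (auto simp: indicator_def)
    also have "\<dots> = ennreal (t powr (\<alpha> / n - 1)) * emeasure lborel {s. 0 < s \<and> t < m s} * indicator {0<..} t"
      by (subst nn_integral_cmult_indicator) (auto simp: mult_ac)
    finally show "(\<integral>\<^sup>+ s. ennreal (t powr (\<alpha> / n - 1)) * indicator {0<..<m s} t * indicator {0<..} s \<partial>lborel)
      = ennreal (t powr (\<alpha> / n - 1)) * emeasure lborel {s. 0 < s \<and> t < m s} * indicator {0<..} t" .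
  qed
  finally show "(\<integral>\<^sup>+ y. ?w y * ennreal (g y) * indicator B y \<partial>lebesgue)
    \<le> ennreal ((1 + (n - \<alpha>) * unit_ball_vol n / \<alpha>) * (\<alpha> / n)) *
      (\<integral>\<^sup>+ t. ennreal (t powr (\<alpha> / n - 1)) * emeasure lborel {s. 0 < s \<and> t < m s} * indicator {0<..} t \<partial>lborel)"
    unfolding C_def .
qed


section \<open>Extended powers and the decreasing rearrangement\<close>

lemma ennpow_less_top_iff: "ennpow x p < top \<longleftrightarrow> x < top"
  by (auto simp: ennpow_def less_top)

lemma ennpow_mono: "x \<le> y \<Longrightarrow> 0 \<le> p \<Longrightarrow> ennpow x p \<le> ennpow y p"
  by (auto simp: ennpow_def top_unique less_top intro!: ennreal_leI powr_mono2 enn2real_mono)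

lemma ennreal_measure_le_emeasure: "ennreal (measure M A) \<le> emeasure M A"
  unfolding measure_def by (simp add: ennreal_enn2real_if)

lemma emeasure_superlevels_le_decr_rearr:
  fixes f :: "real ^ 'n \<Rightarrow> real"
  assumes f[measurable]: "f \<in> borel_measurable lebesgue" and p: "0 < p" and t: "0 \<le> t"
  shows "emeasure lborel {s. 0 < s \<and> t < measure lebesgue {y \<in> B. s < \<bar>f y\<bar> powr p}}
    \<le> ennpow (decr_rearr f t) p"
proof (cases "decr_rearr f t")
  case top
  then show ?thesis by (simp add: ennpow_def)
next
  case (real a)
  have superlevel: "{x. c < \<bar>f x\<bar>} \<in> sets lebesgue" for c
  proof -
    have "{x \<in> space lebesgue. c < \<bar>f x\<bar>} \<in> sets lebesgue" by measurable
    then show ?thesis by simp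
  qed
  have "s \<in> {0<..a powr p}" if s: "0 < s" "t < measure lebesgue {y \<in> B. s < \<bar>f y\<bar> powr p}" for s
  proof -
    define \<tau> where "\<tau> = s powr (1 / p)"
    have \<tau>: "0 < \<tau>" "\<tau> powr p = s" using s p by (auto simp: \<tau>_def powr_powr)
    have "ennreal t < ennreal (measure lebesgue {y \<in> B. s < \<bar>f y\<bar> powr p})"
      using s t by (simp add: ennreal_less_iff)
    also have "\<dots> \<le> emeasure lebesgue {y \<in> B. s < \<bar>f y\<bar> powr p}"
      by (rule ennreal_measure_le_emeasure)
    also have "\<dots> \<le> distr_fun f \<tau>"
      unfolding distr_fun_def
    proof (rule emeasure_mono)
      show "{y \<in> B. s < \<bar>f y\<bar> powr p} \<subseteq> {x. \<tau> < \<bar>f x\<bar>}"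
      proof safe
        fix y assume "s < \<bar>f y\<bar> powr p"
        then show "\<tau> < \<bar>f y\<bar>"
          using powr_mono2[of p "\<bar>f y\<bar>" \<tau>] p \<tau> by linarith
      qed
    qed (rule superlevel)
    finally have *: "ennreal t < distr_fun f \<tau>" .
    have "ennreal \<tau> \<le> decr_rearr f t"
      unfolding decr_rearr_def
    proof (safe intro!: Inf_greatest)
      fix \<sigma> assume \<sigma>: "0 < \<sigma>" "distr_fun f \<sigma> \<le> ennreal t"
      have "distr_fun f \<tau> \<le> distr_fun f \<sigma>" if "\<sigma> \<le> \<tau>"
        unfolding distr_fun_def using that by (intro emeasure_mono superlevel) auto
      then have "\<not> \<sigma> \<le> \<tau>" using * \<sigma>(2) by (meson leD order_trans)
      then show "ennreal \<tau> \<le> ennreal \<sigma>" by (intro ennreal_leI) simp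
    qed
    then have "\<tau> \<le> a" using real \<tau> by simp
    then have "s \<le> a powr p"
      using \<tau> p powr_mono2[of p \<tau> a] by simp
    then show ?thesis using s(1) by simp
  qed
  then have "{s. 0 < s \<and> t < measure lebesgue {y \<in> B. s < \<bar>f y\<bar> powr p}} \<subseteq> {0<..a powr p}"
    by blast
  then have "emeasure lborel {s. 0 < s \<and> t < measure lebesgue {y \<in> B. s < \<bar>f y\<bar> powr p}}
      \<le> emeasure lborel {0<..a powr p}"
    by (rule emeasure_mono) simp
  also have "\<dots> = ennpow (decr_rearr f t) p"
    using real by (simp add: ennpow_def)
  finally show ?thesis .
qed

text \<open>The weight leaves the \<open>p\<close>-th power as \<open>t powr (p / \<kappa>)\<close>,
  and division by \<open>t\<close> lowers its exponent by one. For infinite \<open>a\<close> the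
  right side is infinite.\<close>

lemma lorentz_integrand_ge:
  assumes "0 < t" "0 < p" "0 < \<kappa>"
  shows "ennreal (t powr (p / \<kappa> - 1)) * ennpow a p \<le> ennpow (ennreal (t powr (1 / \<kappa>)) * a) p / ennreal t"
proof (cases a)
  case (real b)
  have "ennpow (ennreal (t powr (1 / \<kappa>)) * a) p = ennreal ((t powr (1 / \<kappa>) * b) powr p)"
    using real by (simp add: ennpow_def flip: ennreal_mult)
  also have "(t powr (1 / \<kappa>) * b) powr p = t powr (p / \<kappa>) * b powr p"
    using real assms by (simp add: powr_mult powr_powr)
  finally show ?thesis
    using real assms by (simp add: ennpow_def divide_ennreal powr_diff flip: ennreal_mult)
next
  case top
  then show ?thesis
    using assms by (simp add: ennpow_def ennreal_mult_top ennreal_top_divide)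
qed

section \<open>Stummel integrals against the Lorentz integral\<close>

text \<open>The centre \<open>x\<close> enters the estimate only through the measure of its ball,
  which depends on \<open>r\<close> alone; hence the bound is uniform in \<open>x\<close>.\<close>

lemma stummel_integral_le_lorentz_integral:
  fixes f :: "real ^ 'n \<Rightarrow> real" and p \<alpha> \<kappa> r :: real
  defines "n \<equiv> real CARD('n)"
  assumes f[measurable]: "f \<in> borel_measurable lebesgue" and p: "0 < p"
    and \<alpha>: "0 < \<alpha>" "\<alpha> < n" and \<kappa>: "n * p / \<alpha> \<le> \<kappa>" and r: "0 < r"
  shows "(\<integral>\<^sup>+ y \<in> {y. norm (x - y) < r}. ennreal (\<bar>f y\<bar> powr p / norm (x - y) powr (n - \<alpha>)) \<partial>lebesgue)
    \<le> ennreal ((1 + (n - \<alpha>) * unit_ball_vol n / \<alpha>) * (\<alpha> / n) *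
        (unit_ball_vol n * r powr n) powr (\<alpha> / n - p / \<kappa>)) *
      (\<integral>\<^sup>+ t \<in> {0<..}. (ennpow (ennreal (t powr (1 / \<kappa>)) * decr_rearr f t) p / ennreal t) \<partial>lborel)"
proof -
  define B where "B = ball x r"
  define M where "M = unit_ball_vol n * r powr n"
  define C where "C = (1 + (n - \<alpha>) * unit_ball_vol n / \<alpha>) * (\<alpha> / n)"
  define m where "m = (\<lambda>s. measure lebesgue {y \<in> B. s < \<bar>f y\<bar> powr p})"
  define \<phi> where "\<phi> = (\<lambda>t. emeasure lborel {s. 0 < s \<and> t < m s})"
  have n: "0 < n" by (simp add: n_def)
  have \<kappa>0: "0 < \<kappa>" using \<kappa> n p \<alpha> by (intro less_le_trans[OF _ \<kappa>]) auto
  \<comment> \<open>The lower bound on \<open>\<kappa>\<close>, rewritten as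
    \<open>p / \<kappa> \<le> \<alpha> / n\<close>.\<close>
  have exponent: "0 \<le> \<alpha> / n - p / \<kappa>"
    using \<kappa> \<kappa>0 n \<alpha> by (simp add: field_simps)
  have C: "0 \<le> C" using \<alpha> n by (simp add: C_def)
  have B[measurable]: "B \<in> sets lebesgue" by (simp add: B_def)
  have M: "emeasure lebesgue B = ennreal M"
    using r by (simp add: B_def M_def n_def emeasure_ball powr_realpow emeasure_completion)
  have M0: "0 \<le> M" using n by (simp add: M_def)
  have m_le: "m s \<le> M" for s
  proof -
    have "m s \<le> measure lebesgue B"
      unfolding m_def using M by (intro measure_mono_fmeasurable) (auto simp: fmeasurable_def)
    also have "\<dots> = M" using M M0 by (simp add: measure_def)
    finally show ?thesis .
  qed
  \<comment> \<open>The kernel lemmas measure dimension by \<open>DIM\<close>, the definitions here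
    by \<open>CARD\<close>.\<close>
  have dim: "real DIM(real ^ 'n) = n" by (simp add: n_def)
  have g: "(\<lambda>y. \<bar>f y\<bar> powr p) \<in> borel_measurable lebesgue" by measurable
  have fin: "emeasure lebesgue B < \<infinity>" by (simp add: M)
  have [measurable]: "m \<in> borel_measurable borel"
    unfolding m_def by (rule borel_measurable_superlevel_measure[OF \<alpha>(1) _ g B fin, unfolded dim, OF \<alpha>(2)])
  have [measurable]: "\<phi> \<in> borel_measurable borel"
    unfolding \<phi>_def by measurable
  have "(\<integral>\<^sup>+ y \<in> {y. norm (x - y) < r}. ennreal (\<bar>f y\<bar> powr p / norm (x - y) powr (n - \<alpha>)) \<partial>lebesgue)
    = (\<integral>\<^sup>+ y. ennreal (norm (x - y) powr (\<alpha> - n)) * ennreal (\<bar>f y\<bar> powr p) * indicator B y \<partial>lebesgue)"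
  proof (rule nn_integral_cong)
    fix y
    \<comment> \<open>At \<open>y = x\<close> both sides are 0, by the conventions for base 0 and
      for division by 0.\<close>
    have "norm (x - y) powr (\<alpha> - n) = 1 / norm (x - y) powr (n - \<alpha>)"
      using powr_minus_divide[of "norm (x - y)" "n - \<alpha>"] by simp
    then show "ennreal (\<bar>f y\<bar> powr p / norm (x - y) powr (n - \<alpha>)) * indicator {y. norm (x - y) < r} y
      = ennreal (norm (x - y) powr (\<alpha> - n)) * ennreal (\<bar>f y\<bar> powr p) * indicator B y"
      by (simp add: B_def indicator_def dist_norm flip: ennreal_mult)
  qed
  also have "\<dots> \<le> ennreal C * (\<integral>\<^sup>+ t. ennreal (t powr (\<alpha> / n - 1)) * \<phi> t * indicator {0<..} t \<partial>lborel)"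
    unfolding C_def \<phi>_def m_def
    by (rule nn_integral_Riesz_kernel_layer_cake[OF \<alpha>(1) _ g B fin, unfolded dim, OF \<alpha>(2)])
  also have "(\<integral>\<^sup>+ t. ennreal (t powr (\<alpha> / n - 1)) * \<phi> t * indicator {0<..} t \<partial>lborel)
    \<le> (\<integral>\<^sup>+ t. ennreal (M powr (\<alpha> / n - p / \<kappa>)) *
        (ennreal (t powr (p / \<kappa> - 1)) * \<phi> t * indicator {0<..} t) \<partial>lborel)"
  proof (rule nn_integral_mono)
    fix t :: real
    show "ennreal (t powr (\<alpha> / n - 1)) * \<phi> t * indicator {0<..} t \<le> ennreal (M powr (\<alpha> / n - p / \<kappa>)) *
        (ennreal (t powr (p / \<kappa> - 1)) * \<phi> t * indicator {0<..} t)"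
    proof (cases "0 < t \<and> t < M")
      case True
      have "t powr (\<alpha> / n - 1) = t powr (\<alpha> / n - p / \<kappa>) * t powr (p / \<kappa> - 1)"
        by (simp flip: powr_add)
      also have "\<dots> \<le> M powr (\<alpha> / n - p / \<kappa>) * t powr (p / \<kappa> - 1)"
        using True exponent by (intro mult_right_mono powr_mono2) auto
      finally have "ennreal (t powr (\<alpha> / n - 1)) \<le>
          ennreal (M powr (\<alpha> / n - p / \<kappa>)) * ennreal (t powr (p / \<kappa> - 1))"
        by (simp add: ennreal_leI flip: ennreal_mult)
      from mult_right_mono[OF this, of "\<phi> t"] show ?thesis
        using True by (simp add: mult_ac)
    next
      case False
      \<comment> \<open>The comparison of weights may fail for large \<open>t\<close>, but no subset
        of \<open>B\<close> has measure above \<open>M\<close>, so these \<open>t\<close> contribute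
        nothing.\<close>
      have "\<phi> t = 0" if "M \<le> t"
      proof -
        have empty: "{s. 0 < s \<and> t < m s} = {}" using that m_le by (auto simp: not_less intro: order_trans)
        show ?thesis by (simp only: \<phi>_def empty emeasure_empty)
      qed
      with False show ?thesis by (auto simp: indicator_def)
    qed
  qed
  also have "\<dots> = ennreal (M powr (\<alpha> / n - p / \<kappa>)) *
      (\<integral>\<^sup>+ t. ennreal (t powr (p / \<kappa> - 1)) * \<phi> t * indicator {0<..} t \<partial>lborel)"
    by (rule nn_integral_cmult) measurable
  also have "(\<integral>\<^sup>+ t. ennreal (t powr (p / \<kappa> - 1)) * \<phi> t * indicator {0<..} t \<partial>lborel) \<le>
    (\<integral>\<^sup>+ t \<in> {0<..}. (ennpow (ennreal (t powr (1 / \<kappa>)) * decr_rearr f t) p / ennreal t) \<partial>lborel)"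
  proof (rule nn_integral_mono)
    fix t :: real
    show "ennreal (t powr (p / \<kappa> - 1)) * \<phi> t * indicator {0<..} t \<le>
      ennpow (ennreal (t powr (1 / \<kappa>)) * decr_rearr f t) p / ennreal t * indicator {0<..} t"
    proof (cases "0 < t")
      case True
      have "\<phi> t \<le> ennpow (decr_rearr f t) p"
        unfolding \<phi>_def m_def using f p True by (intro emeasure_superlevels_le_decr_rearr) auto
      from order_trans[OF mult_left_mono[OF this] lorentz_integrand_ge[OF True p \<kappa>0]]
      show ?thesis using True by simp
    qed simp
  qed
  finally show ?thesis
    unfolding C_def[symmetric] M_def[symmetric] ennreal_mult[OF C powr_ge_zero]
    by (simp add: mult.assoc mult_left_mono)
qed

section \<open>The inclusion of the Lorentz space\<close>

theorem theorem5p6: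
  fixes p \<alpha> \<kappa> :: real
  assumes "1 \<le> p"
    and "0 < \<alpha>" and "\<alpha> < real CARD('n::finite)"
    and "real CARD('n) * p / \<alpha> \<le> \<kappa>"
  shows "(lorentz_space \<kappa> p :: (real ^ 'n \<Rightarrow> real) set) \<subseteq> bounded_stummel p \<alpha>"
proof
  fix f :: "real ^ 'n \<Rightarrow> real"
  assume "f \<in> lorentz_space \<kappa> p"
  then have f[measurable]: "f \<in> borel_measurable lebesgue"
    and N: "(\<integral>\<^sup>+ t \<in> {0<..}. (ennpow (ennreal (t powr (1 / \<kappa>)) * decr_rearr f t) p / ennreal t) \<partial>lborel) < \<infinity>"
    by (auto simp: lorentz_space_def lorentz_norm_def ennpow_less_top_iff)
  let ?n = "real CARD('n)"
  let ?I = "\<lambda>x r. \<integral>\<^sup>+ y \<in> {y. norm (x - y) < r}.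
    ennreal (\<bar>f y\<bar> powr p / norm (x - y) powr (?n - \<alpha>)) \<partial>lebesgue"
  have bound: "\<exists>K<\<infinity>. \<forall>x. ?I x r \<le> K" if "0 < r" for r
  proof -
    have "0 < p" using assms(1) by simp
    note le = stummel_integral_le_lorentz_integral[OF f this assms(2-4) that]
    show ?thesis
      \<comment> \<open>Unification takes the right side of \<open>le\<close> as the witness, which
        is possible because \<open>x\<close> does not occur there.\<close>
      by (rule exI, rule conjI[OF _ allI[OF le]]) (use N in \<open>simp add: ennreal_mult_less_top\<close>)
  qed
  have "stummel_modulus p \<alpha> f r < \<infinity>" if r: "0 < r" for r
  proof -
    obtain K where K: "K < \<infinity>" "\<And>x. ?I x r \<le> K" using bound[OF r] by blast
    then have "stummel_modulus p \<alpha> f r \<le> ennpow K (1 / p)"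
      unfolding stummel_modulus_def using assms(1) by (intro SUP_least ennpow_mono) auto
    also have "\<dots> < \<infinity>" using K by (simp add: ennpow_less_top_iff)
    finally show ?thesis .
  qed
  moreover have "(\<integral>\<^sup>+ y \<in> K. ennreal (\<bar>f y\<bar> powr p) \<partial>lebesgue) < \<infinity>" if K: "compact K" for K
  proof -
    \<comment> \<open>Local integrability comes from the Stummel integral centred at 0: on a ball of
      radius \<open>R\<close> the kernel is bounded below by \<open>R powr (\<alpha> - ?n)\<close>
      away from the origin.\<close>
    obtain R where R: "0 < R" "K \<subseteq> ball 0 R"
      using compact_imp_bounded[OF K] bounded_subset_ballD[of K 0] by auto
    obtain J where J: "J < \<infinity>" "?I 0 R \<le> J" using bound[OF R(1)] by blast
    \<comment> \<open>The origin must be left out: the quotient is 0 there by convention, while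
      \<open>f\<close> need not vanish.\<close>
    have "AE y in lborel. y \<noteq> (0 :: real ^ 'n)" by (rule AE_lborel_singleton)
    then have "AE y in lebesgue. y \<noteq> (0 :: real ^ 'n)" by (rule AE_completion)
    then have "AE y in lebesgue. ennreal (\<bar>f y\<bar> powr p) * indicator K y \<le>
      ennreal (R powr (?n - \<alpha>)) * (ennreal (\<bar>f y\<bar> powr p / norm (0 - y) powr (?n - \<alpha>)) *
        indicator {y. norm (0 - y) < R} y)"
    proof eventually_elim
      case (elim y)
      show ?case
      proof (cases "y \<in> K")
        case True
        then have y: "norm y < R" using R by auto
        then have "norm y powr (?n - \<alpha>) \<le> R powr (?n - \<alpha>)"
          using assms by (intro powr_mono2) auto
        then have "\<bar>f y\<bar> powr p * norm y powr (?n - \<alpha>) \<le> R powr (?n - \<alpha>) * \<bar>f y\<bar> powr p"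
          by (subst mult.commute) (simp add: mult_right_mono)
        then have "\<bar>f y\<bar> powr p \<le> R powr (?n - \<alpha>) * (\<bar>f y\<bar> powr p / norm y powr (?n - \<alpha>))"
          using elim by (simp add: field_simps)
        then show ?thesis
          using True y by (simp add: ennreal_leI flip: ennreal_mult)
      qed simp
    qed
    from nn_integral_mono_AE[OF this]
    have "(\<integral>\<^sup>+ y \<in> K. ennreal (\<bar>f y\<bar> powr p) \<partial>lebesgue) \<le> ennreal (R powr (?n - \<alpha>)) * ?I 0 R"
    proof (subst (asm) nn_integral_cmult)
      have [measurable]: "norm \<in> borel_measurable (lebesgue :: (real ^ 'n) measure)"
        by (rule measurable_completion) simp
      show "(\<lambda>y. ennreal (\<bar>f y\<bar> powr p / norm (0 - y) powr (?n - \<alpha>)) *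
          indicator {y. norm (0 - y) < R} y) \<in> borel_measurable lebesgue"
        by (simp add: indicator_def)
    qed
    also have "\<dots> < \<infinity>"
      using J by (auto simp: ennreal_mult_less_top)
    finally show ?thesis .
  qed
  ultimately show "f \<in> bounded_stummel p \<alpha>"
    using f by (auto simp: bounded_stummel_def Lp_loc_def)
qed

end
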